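(* Let $n\ge1$ and let $A\subseteq\{0,1\}^n$ be nonempty. Let $Y$ be the random variable defined as follows: choose $a\in A$ uniformly at random and run the simple random walk on $\{0,1\}^n$ started at $a$; $Y$ is the first time at which the walk is outside $A$. Then \[ \mathbb{E}\,Y\;\le\;\frac{n}{\log_2\!\left(\frac{2^n}{|A|}\right)} . \] Moreover, if $A$ is a subcube, equality holds. In particular, subcubes maximize the mean first exit time $\mathbb{E}Y$ among all subsets of $\{0,1\}^n$ of the same cardinality.
   Context: The discrete cube $\{0,1\}^n$ is the graph whose vertices are binary strings of length $n$, two being adjacent iff they differ in exactly one coordinate. The simple random walk moves at each step to a uniformly random one of the $n$ neighbors of the current vertex; the walk at time $0$ is at $a\in A$, so $Y\ge1$. A subcube is a set obtained by fixing the values of some subset of the coordinates and letting the others range freely. When $A=\{0,1\}^n$ both sides are interpreted as $+\infty$. *)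

theory Defs
  imports "HOL-Probability.Probability"
begin

text \<open>The discrete cube: binary strings are lists of Booleans.\<close>

definition cube :: "nat \<Rightarrow> bool list set" where
  "cube n = {x. length x = n}"

definition neighbors :: "nat \<Rightarrow> bool list \<Rightarrow> bool list set" where
  "neighbors n x = {y \<in> cube n. card {i. i < n \<and> x ! i \<noteq> y ! i} = 1}"

definition subcube :: "nat \<Rightarrow> bool list set \<Rightarrow> bool" where
  "subcube n B \<longleftrightarrow>
     (\<exists>S c. S \<subseteq> {..<n} \<and> B = {x \<in> cube n. \<forall>i\<in>S. x ! i = c i})"

text \<open>
  A process \<open>X\<close> on an arbitrary probability space is the simple random walk on
  the \<open>n\<close>-cube started from a uniformly random point of \<open>A\<close> if, given the whole history
  up to time \<open>t\<close>, the next position is uniform on the neighbors of the current one.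
  The conditional law is written in product form, so histories of probability zero
  impose no condition on the transition.
\<close>

locale cube_random_walk = prob_space M
  for M :: "'w measure" +
  fixes n :: nat and A :: "bool list set" and X :: "nat \<Rightarrow> 'w \<Rightarrow> bool list"
  assumes random_variable_X: "\<And>t. X t \<in> measurable M (count_space UNIV)"
    and start: "\<And>a. prob {\<omega> \<in> space M. X 0 \<omega> = a} = pmf (pmf_of_set A) a"
    and step: "\<And>t x. prob {\<omega> \<in> space M. \<forall>s\<le>Suc t. X s \<omega> = x s} =
        prob {\<omega> \<in> space M. \<forall>s\<le>t. X s \<omega> = x s} *
        pmf (pmf_of_set (neighbors n (x t))) (x (Suc t))"

text \<open>The infimum is \<open>\<infinity>\<close> if the walk never leaves \<open>A\<close>.\<close>

definition exit_time :: "bool list set \<Rightarrow> (nat \<Rightarrow> 'w \<Rightarrow> bool list) \<Rightarrow> 'w \<Rightarrow> enat" where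
  "exit_time A X \<omega> = Inf {enat t | t. X t \<omega> \<notin> A}"

definition mean_exit_time ::
    "'w measure \<Rightarrow> bool list set \<Rightarrow> (nat \<Rightarrow> 'w \<Rightarrow> bool list) \<Rightarrow> ennreal" where
  "mean_exit_time M A X = (\<integral>\<^sup>+\<omega>. ennreal_of_enat (exit_time A X \<omega>) \<partial>M)"

text \<open>
  The division is taken in \<^typ>\<open>ennreal\<close>, where \<open>x / 0 = \<infinity>\<close> for \<open>x > 0\<close>; hence the
  bound is \<open>\<infinity>\<close> when \<open>A\<close> is the whole cube and \<open>n \<ge> 1\<close>.
\<close>

definition exit_bound :: "nat \<Rightarrow> bool list set \<Rightarrow> ennreal" where
  "exit_bound n A = ennreal (real n) / ennreal (log 2 (2 ^ n / real (card A)))"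

end

theory Submission imports Defs begin

text \<open>
  Write \<open>E(f)\<close> for the Dirichlet form \<open>\<Sum>x. f x * (\<Sum>i. f x - f (flip i x))\<close>. The key is
  a functional form of Harper's edge-isoperimetric inequality: for \<open>f \<ge> 0\<close> supported in \<open>A\<close>,
  \<open>(\<Sum>f)\<^sup>2 / |A| * log\<^sub>2 (2^n / |A|) \<le> E(f)\<close>. It follows by induction on the
  dimension from a two-point inequality. Apply it to \<open>U y\<close>, the expected number of visits to \<open>y\<close>
  before time \<open>T\<close> and before exiting: on \<open>A\<close> the function \<open>U\<close> satisfies
  \<open>n * U y - (\<Sum>i. U (flip i y)) \<le> n / |A|\<close>, so \<open>E(U) \<le> n / |A| * \<Sum>U\<close> and therefore
  \<open>\<Sum>U * log\<^sub>2 (2^n / |A|) \<le> n\<close>. As \<open>T\<close> grows, \<open>\<Sum>U\<close> tends to the mean exit time.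
  In a subcube with \<open>k\<close> free coordinates the walk stays inside with probability \<open>k / n\<close> at each
  step, so the exit time is geometric with mean \<open>n / (n - k)\<close>.
\<close>

section \<open>A two-point inequality for the logarithm\<close>

text \<open>The logarithm is concave, and the two sides agree at \<open>r = 0\<close> and
  \<open>r = 1\<close>.\<close>

lemma log2_ge_chord:
  fixes r :: real
  assumes "0 \<le> r" "r \<le> 1"
  shows "r \<le> log 2 (1 + r)"
  using concave_onD[OF log_concave[of 2], of r 1 2] assms by (simp add: algebra_simps)

text \<open>This is the induction step of \<open>energy_ge\<close>: \<open>a\<close>,
  \<open>b\<close> are the sums of \<open>f\<close> over the two half cubes, \<open>p\<close>,
  \<open>q\<close> the sizes of the parts of \<open>A\<close> in them, and the last term bounds the
  energy between the halves from below. The proof splits off the multiples of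
  \<open>log 2 (N / p)\<close>, for which convexity of the square suffices; the rest no longer
  involves \<open>N\<close>.\<close>

lemma two_point_inequality:
  fixes a b p q N :: real
  assumes q: "0 < q" "q \<le> p" and p: "p \<le> N"
  shows "(a + b)\<^sup>2 / (p + q) * log 2 (2 * N / (p + q))
    \<le> a\<^sup>2 / p * log 2 (N / p) + b\<^sup>2 / q * log 2 (N / q) + (a - b)\<^sup>2 / p"
proof -
  define l where "l = log 2 (N / p)"
  define k where "k = log 2 (p / q)"
  define m where "m = log 2 (2 * p / (p + q))"
  have pos: "p > 0" "N > 0" "p + q > 0" "p \<noteq> 0" "q \<noteq> 0" "N \<noteq> 0" "p + q \<noteq> 0"
    using assms by linarith+
  have e1: "log 2 (2 * N / (p + q)) = l + m"
    using pos q by (simp add: l_def m_def log_divide log_mult)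
  have e2: "log 2 (N / q) = l + k"
    using pos q by (simp add: l_def k_def log_divide)
  have l0: "l \<ge> 0" unfolding l_def using pos p by simp
  have m0: "m \<ge> 0" unfolding m_def using pos q by simp
  \<comment> \<open>This is the inequality of arithmetic and geometric means,
    \<open>4 * p * q \<le> (p + q)^2\<close>, in logarithmic form.\<close>
  have km: "2 * m \<le> k"
  proof -
    have "2 * m = log 2 ((2 * p / (p + q))\<^sup>2)"
      unfolding m_def using pos q by (simp add: log_nat_power)
    also have "\<dots> \<le> k"
      unfolding k_def
    proof (subst log_le_cancel_iff)
      have "p / q - (2 * p / (p + q))\<^sup>2 = p * (p - q)\<^sup>2 / (q * (p + q)\<^sup>2)"
        using pos by (simp add: divide_simps power2_eq_square) (simp add: algebra_simps)
      also have "\<dots> \<ge> 0" using pos q by simp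
      finally show "(2 * p / (p + q))\<^sup>2 \<le> p / q" by simp
    qed (use pos q in auto)
    finally show ?thesis .
  qed
  have m1: "m \<le> (p - q) / p"
  proof -
    have "q / p \<le> log 2 (1 + q / p)"
      by (rule log2_ge_chord) (use pos q in auto)
    also have "1 + q / p = (p + q) / p" using pos by (simp add: field_simps)
    also have "log 2 ((p + q) / p) = 1 - m"
      using pos q by (simp add: m_def log_divide log_mult)
    finally show ?thesis using pos by (simp add: diff_divide_distrib)
  qed
  have i: "(a + b)\<^sup>2 / (p + q) \<le> a\<^sup>2 / p + b\<^sup>2 / q"
  proof -
    have "a\<^sup>2 / p + b\<^sup>2 / q - (a + b)\<^sup>2 / (p + q) = (q * a - p * b)\<^sup>2 / (p * q * (p + q))"
      using pos q by (simp add: divide_simps) (simp add: power2_eq_square algebra_simps)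
    also have "\<dots> \<ge> 0" using pos q by simp
    finally show ?thesis by simp
  qed
  \<comment> \<open>What multiplies \<open>m\<close> once \<open>k\<close> is replaced by its lower
    bound \<open>2 * m\<close>. Only a positive \<open>c\<close> calls for the upper bound
    \<open>m1\<close>, and then the slack is a perfect square times a positive factor.\<close>
  define c where "c = (a + b)\<^sup>2 / (p + q) - 2 * b\<^sup>2 / q"
  have "m * c \<le> (a - b)\<^sup>2 / p"
  proof (cases "c \<le> 0")
    case True
    then have "m * c \<le> 0" using m0 by (simp add: mult_nonneg_nonpos)
    also have "0 \<le> (a - b)\<^sup>2 / p" using pos by simp
    finally show ?thesis .
  next
    case False
    then have "m * c \<le> (p - q) / p * c" using m1 by (intro mult_right_mono) auto
    also have "\<dots> \<le> (a - b)\<^sup>2 / p"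
    proof -
      have "(a - b)\<^sup>2 / p - (p - q) / p * c = 2 * (q * a - p * b)\<^sup>2 / (p * q * (p + q))"
        unfolding c_def
        using pos q by (simp add: divide_simps) (simp add: power2_eq_square algebra_simps)
      also have "\<dots> \<ge> 0" using pos q by simp
      finally show ?thesis by simp
    qed
    finally show ?thesis .
  qed
  moreover have "b\<^sup>2 / q * (2 * m) \<le> b\<^sup>2 / q * k"
    using km q by (intro mult_left_mono) auto
  ultimately have ii: "(a + b)\<^sup>2 / (p + q) * m \<le> b\<^sup>2 / q * k + (a - b)\<^sup>2 / p"
    unfolding c_def by (simp add: algebra_simps)
  have "(a + b)\<^sup>2 / (p + q) * l \<le> (a\<^sup>2 / p + b\<^sup>2 / q) * l"
    using i l0 by (rule mult_right_mono)
  with ii show ?thesis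
    unfolding e1 e2 l_def[symmetric] by (simp only: distrib_left distrib_right)
qed

section \<open>The Dirichlet form and edge isoperimetry\<close>

definition flip :: "nat \<Rightarrow> bool list \<Rightarrow> bool list" where
  "flip i x = x[i := \<not> x ! i]"

text \<open>Equal to the sum of \<open>(f x - f y)^2\<close> over all edges. The unsymmetrized form
  lets a pointwise bound on the inner sum be multiplied by \<open>f x\<close> and added up.\<close>

definition energy :: "nat \<Rightarrow> (bool list \<Rightarrow> real) \<Rightarrow> real" where
  "energy n f = (\<Sum>x\<in>cube n. f x * (\<Sum>i<n. f x - f (flip i x)))"

lemma finite_cube: "finite (cube n)"
  unfolding cube_def using finite_lists_length_eq[of "UNIV :: bool set" n] by simp

lemma card_cube: "card (cube n) = 2 ^ n"
  unfolding cube_def using card_lists_length_eq[of "UNIV :: bool set" n] by simp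

lemma flip_in_cube: "flip i x \<in> cube n \<longleftrightarrow> x \<in> cube n"
  by (simp add: flip_def cube_def)

lemma nth_flip: "i < length x \<Longrightarrow> flip i x ! j = (if j = i then \<not> x ! i else x ! j)"
  by (simp add: flip_def nth_list_update)

lemma flip_Cons:
  "flip 0 (b # x) = (\<not> b) # x" "flip (Suc i) (b # x) = b # flip i x"
  by (simp_all add: flip_def)

lemma sum_cube_Suc:
  fixes f :: "bool list \<Rightarrow> real"
  shows "sum f (cube (Suc n)) = (\<Sum>x\<in>cube n. f (True # x)) + (\<Sum>x\<in>cube n. f (False # x))"
proof -
  have "cube (Suc n) = Cons True ` cube n \<union> Cons False ` cube n"
  proof (rule set_eqI)
    fix x show "x \<in> cube (Suc n) \<longleftrightarrow> x \<in> Cons True ` cube n \<union> Cons False ` cube n"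
      by (cases x) (auto simp: cube_def)
  qed
  also have "sum f \<dots> = sum f (Cons True ` cube n) + sum f (Cons False ` cube n)"
    by (rule sum.union_disjoint) (auto simp: finite_cube)
  finally show ?thesis by (simp add: sum.reindex)
qed

text \<open>Edges in direction 0 match the two half cubes, and the two ends of such an edge together
  contribute a square; all other edges stay within a half.\<close>

lemma energy_Suc:
  "energy (Suc n) f = energy n (\<lambda>x. f (True # x)) + energy n (\<lambda>x. f (False # x))
     + (\<Sum>x\<in>cube n. (f (True # x) - f (False # x))\<^sup>2)"
  unfolding energy_def sum_cube_Suc
  by (simp add: sum.lessThan_Suc_shift flip_Cons sum.distrib[symmetric] power2_eq_square algebra_simps
      del: sum.lessThan_Suc)

text \<open>
  Nonnegativity of \<open>h\<close> lets the sum be restricted to \<open>A\<close>, which makes the constant the size of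
  the support of \<open>g\<close> alone instead of that of \<open>g - h\<close>.
\<close>
lemma square_sum_diff_le:
  fixes g h :: "'a \<Rightarrow> real"
  assumes C: "finite C" "A \<subseteq> C" and h: "\<And>x. x \<in> C \<Longrightarrow> 0 \<le> h x"
    and g: "\<And>x. x \<in> C - A \<Longrightarrow> g x = 0" and le: "sum h C \<le> sum g C"
  shows "(sum g C - sum h C)\<^sup>2 \<le> real (card A) * (\<Sum>x\<in>C. (g x - h x)\<^sup>2)"
proof -
  have "sum g C = sum g A" using C g by (intro sum.mono_neutral_right) auto
  moreover have "sum h A \<le> sum h C" using C h by (intro sum_mono2) auto
  ultimately have "sum g C - sum h C \<le> (\<Sum>x\<in>A. g x - h x)" by (simp add: sum_subtractf)
  then have "(sum g C - sum h C)\<^sup>2 \<le> (\<Sum>x\<in>A. g x - h x)\<^sup>2"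
    using le by (intro power_mono) auto
  also have "\<dots> \<le> real (card A) * (\<Sum>x\<in>A. (g x - h x)\<^sup>2)"
    using Cauchy_Schwarz_ineq_sum[of "\<lambda>_. 1" "\<lambda>x. g x - h x" A] by simp
  also have "\<dots> \<le> real (card A) * (\<Sum>x\<in>C. (g x - h x)\<^sup>2)"
    using C by (intro mult_left_mono sum_mono2) auto
  finally show ?thesis .
qed

text \<open>For the indicator of \<open>A\<close> this is the edge-isoperimetric inequality, the
  energy then being the number of boundary edges. The induction splits the cube along the first
  coordinate.\<close>

lemma energy_ge:
  assumes "A \<subseteq> cube n" "\<And>x. x \<in> cube n \<Longrightarrow> 0 \<le> f x" "\<And>x. x \<in> cube n - A \<Longrightarrow> f x = 0"
  shows "(sum f (cube n))\<^sup>2 / real (card A) * log 2 (2 ^ n / real (card A)) \<le> energy n f"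
  using assms
proof (induction n arbitrary: A f)
  case 0
  then have "A = {} \<or> A = {[]}" by (auto simp: cube_def)
  \<comment> \<open>For \<open>A = {}\<close> the left side is 0 because division by zero gives 0;
    for \<open>A = {[]}\<close> the logarithm is \<open>log 2 1\<close>.\<close>
  then show ?case by (auto simp: energy_def)
next
  case (Suc n)
  define A1 where "A1 = {x. True # x \<in> A}"
  define A0 where "A0 = {x. False # x \<in> A}"
  define g where "g x = f (True # x)" for x
  define h where "h x = f (False # x)" for x
  define D where "D = (\<Sum>x\<in>cube n. (g x - h x)\<^sup>2)"
  define a where "a = sum g (cube n)"
  define b where "b = sum h (cube n)"
  define p where "p = real (card A1)"
  define q where "q = real (card A0)"
  note C = finite_cube[of n]
  have sub: "A1 \<subseteq> cube n" "A0 \<subseteq> cube n"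
    using Suc.prems(1) by (auto simp: A1_def A0_def cube_def)
  have Cons_cube: "c # x \<in> cube (Suc n) \<longleftrightarrow> x \<in> cube n" for c x by (simp add: cube_def)
  have g: "\<And>x. x \<in> cube n \<Longrightarrow> 0 \<le> g x" "\<And>x. x \<in> cube n - A1 \<Longrightarrow> g x = 0"
    and h: "\<And>x. x \<in> cube n \<Longrightarrow> 0 \<le> h x" "\<And>x. x \<in> cube n - A0 \<Longrightarrow> h x = 0"
    using Suc.prems(2,3) by (auto simp: g_def h_def A1_def A0_def Cons_cube)
  have fin: "finite A1" "finite A0" using sub C finite_subset by auto
  have "A = Cons True ` A1 \<union> Cons False ` A0"
  proof (rule set_eqI)
    fix x show "x \<in> A \<longleftrightarrow> x \<in> Cons True ` A1 \<union> Cons False ` A0"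
    proof (cases x)
      case Nil
      then show ?thesis using Suc.prems(1) by (auto simp: cube_def)
    next
      case (Cons c y)
      then show ?thesis by (cases c) (auto simp: A1_def A0_def)
    qed
  qed
  then have "card A = card (Cons True ` A1) + card (Cons False ` A0)"
    using fin by (auto intro!: card_Un_disjoint)
  then have cardA: "real (card A) = p + q" by (simp add: p_def q_def card_image)
  have sumf: "sum f (cube (Suc n)) = a + b" by (simp add: sum_cube_Suc a_def b_def g_def h_def)
  have bounds: "0 \<le> p" "0 \<le> q" "p \<le> 2 ^ n" "q \<le> 2 ^ n"
    using card_mono[OF C sub(1)] card_mono[OF C sub(2)] by (simp_all add: p_def q_def card_cube flip: of_nat_le_iff)
  have D0: "D \<ge> 0" unfolding D_def by (simp add: sum_nonneg)
  \<comment> \<open>The half with the larger sum supplies the factor, and it need not be the half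
    with the larger support; the maximum covers both cases.\<close>
  have gap: "(a - b)\<^sup>2 \<le> max p q * D"
  proof (cases "b \<le> a")
    case True
    have "(a - b)\<^sup>2 \<le> p * D" unfolding a_def b_def p_def D_def
      by (rule square_sum_diff_le) (use C sub g h True in \<open>auto simp: a_def b_def\<close>)
    also have "\<dots> \<le> max p q * D" using D0 by (intro mult_right_mono) auto
    finally show ?thesis .
  next
    case False
    have "(b - a)\<^sup>2 \<le> q * (\<Sum>x\<in>cube n. (h x - g x)\<^sup>2)" unfolding a_def b_def q_def
      by (rule square_sum_diff_le) (use C sub g h False in \<open>auto simp: a_def b_def\<close>)
    also have "\<dots> = q * D" by (simp add: D_def power2_commute)
    also have "\<dots> \<le> max p q * D" using D0 by (intro mult_right_mono) auto
    finally show ?thesis by (simp add: power2_commute)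
  qed
  have zero: "p = 0 \<Longrightarrow> a = 0" "q = 0 \<Longrightarrow> b = 0"
    using g(2) h(2) fin by (auto simp: p_def q_def a_def b_def)
  \<comment> \<open>Extends the inequality to \<open>q = 0\<close>, where the factor 2 in the
    logarithm adds exactly \<open>a^2 / p\<close>, which \<open>D\<close> pays for. The variables
    are generic so that the halves can be exchanged.\<close>
  have two_point: "(a + b)\<^sup>2 / (p + q) * log 2 (2 * 2 ^ n / (p + q))
    \<le> a\<^sup>2 / p * log 2 (2 ^ n / p) + b\<^sup>2 / q * log 2 (2 ^ n / q) + D"
    if "q \<le> p" "0 \<le> q" "p \<le> 2 ^ n" "(a - b)\<^sup>2 \<le> p * D" "p = 0 \<Longrightarrow> a = 0" "q = 0 \<Longrightarrow> b = 0"
    for a b p q :: real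
  proof (cases "q = 0")
    case True
    show ?thesis
    proof (cases "p = 0")
      case False
      have "log 2 (2 * 2 ^ n / p) = 1 + log 2 (2 ^ n / p)"
        using that False True by (simp add: log_divide log_mult)
      moreover have "a\<^sup>2 / p \<le> D" using that False True by (simp add: field_simps)
      ultimately show ?thesis using that True by (simp add: algebra_simps)
    qed (use that True D0 in auto)
  next
    case False
    then have "0 < q" using that by simp
    moreover from this have "(a - b)\<^sup>2 / p \<le> D" using that by (simp add: field_simps)
    ultimately show ?thesis using two_point_inequality[of q p "2 ^ n" a b] that by simp
  qed
  have "(sum f (cube (Suc n)))\<^sup>2 / real (card A) * log 2 (2 ^ Suc n / real (card A))
    \<le> a\<^sup>2 / p * log 2 (2 ^ n / p) + b\<^sup>2 / q * log 2 (2 ^ n / q) + D"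
  proof (cases "q \<le> p")
    case True
    then show ?thesis unfolding cardA sumf using two_point[of q p a b] gap bounds zero by (simp add: max_def)
  next
    case False
    then show ?thesis unfolding cardA sumf using two_point[of p q b a] gap bounds zero
      by (simp add: max_def add_ac power2_commute)
  qed
  also have "\<dots> \<le> energy n g + energy n h + D"
    using Suc.IH[OF sub(1), of g] Suc.IH[OF sub(2), of h] g h
    by (simp add: a_def b_def p_def q_def)
  also have "\<dots> = energy (Suc n) f"
    unfolding energy_Suc D_def g_def h_def by simp
  finally show ?case .
qed

section \<open>Neighbors, exit events and subcubes\<close>

lemma neighbors_eq_flip_image:
  assumes x: "x \<in> cube n"
  shows "neighbors n x = (\<lambda>i. flip i x) ` {..<n}"
proof (intro equalityI subsetI)
  fix y assume "y \<in> neighbors n x"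
  then have y: "y \<in> cube n" and "card {i. i < n \<and> x ! i \<noteq> y ! i} = 1"
    by (auto simp: neighbors_def)
  then obtain i where i: "{j. j < n \<and> x ! j \<noteq> y ! j} = {i}" by (auto simp: card_1_singleton_iff)
  have "y = flip i x"
  proof (rule nth_equalityI)
    show "length y = length (flip i x)" using x y by (simp add: flip_def cube_def)
    fix j assume "j < length y"
    then have "j < n" using y by (simp add: cube_def)
    then have "x ! j \<noteq> y ! j \<longleftrightarrow> j = i" using i by blast
    then show "y ! j = flip i x ! j"
      using x \<open>j < n\<close> by (auto simp: flip_def cube_def nth_list_update)
  qed
  then show "y \<in> (\<lambda>i. flip i x) ` {..<n}" using i by auto
next
  fix y assume "y \<in> (\<lambda>i. flip i x) ` {..<n}"
  then obtain i where i: "i < n" "y = flip i x" by auto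
  then have "{j. j < n \<and> x ! j \<noteq> y ! j} = {i}"
    using x by (auto simp: nth_flip cube_def)
  then show "y \<in> neighbors n x" using i x by (simp add: neighbors_def flip_in_cube)
qed

lemma inj_on_flip: "x \<in> cube n \<Longrightarrow> inj_on (\<lambda>i. flip i x) {..<n}"
proof (rule inj_onI)
  fix i j assume x: "x \<in> cube n" and "i \<in> {..<n}" "j \<in> {..<n}" and eq: "flip i x = flip j x"
  then have "i < length x" "j < length x" by (auto simp: cube_def)
  then show "i = j" using arg_cong[OF eq, of "\<lambda>z. z ! i"] by (auto simp: nth_flip split: if_splits)
qed

lemma card_neighbors: "x \<in> cube n \<Longrightarrow> card (neighbors n x) = n"
  by (simp add: neighbors_eq_flip_image card_image inj_on_flip)

lemma finite_neighbors: "finite (neighbors n x)"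
  by (rule finite_subset[OF _ finite_cube[of n]]) (auto simp: neighbors_def)

lemma neighbors_sym:
  "x \<in> cube n \<Longrightarrow> y \<in> cube n \<Longrightarrow> y \<in> neighbors n x \<longleftrightarrow> x \<in> neighbors n y"
proof -
  have "{i. i < n \<and> x ! i \<noteq> y ! i} = {i. i < n \<and> y ! i \<noteq> x ! i}" by auto
  then show "x \<in> cube n \<Longrightarrow> y \<in> cube n \<Longrightarrow> y \<in> neighbors n x \<longleftrightarrow> x \<in> neighbors n y"
    by (simp only: neighbors_def mem_Collect_eq)
qed

text \<open>The strict inequality is \<open>enat (Suc t) \<le> exit_time A X \<omega>\<close>, which
  an infimum satisfies iff every member of the set does.\<close>

lemma enat_less_exit_time:
  "enat t < exit_time A X \<omega> \<longleftrightarrow> (\<forall>s\<le>t. X s \<omega> \<in> A)"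
  by (auto simp: exit_time_def Suc_ile_eq[symmetric] le_Inf_iff not_less_eq_eq)

text \<open>A point of the subcube corresponds to the set of free coordinates at which it is
  true.\<close>

lemma card_fixed_coordinates:
  assumes "S \<subseteq> {..<n}"
  shows "card {x \<in> cube n. \<forall>i\<in>S. x ! i = c i} = 2 ^ (n - card S)"
proof -
  let ?B = "{x \<in> cube n. \<forall>i\<in>S. x ! i = c i}"
  have "bij_betw (\<lambda>x. {i \<in> {..<n} - S. x ! i}) ?B (Pow ({..<n} - S))"
    by (rule bij_betw_byWitness[where f' = "\<lambda>T. map (\<lambda>i. if i \<in> S then c i else i \<in> T) [0..<n]"])
      (use assms in \<open>auto simp: cube_def subset_iff intro!: nth_equalityI\<close>)
  then have "card ?B = card (Pow ({..<n} - S))" by (rule bij_betw_same_card)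
  also have "\<dots> = 2 ^ (n - card S)"
    using assms by (simp add: card_Pow card_Diff_subset finite_subset)
  finally show ?thesis .
qed

section \<open>The walk killed on leaving the set\<close>

context cube_random_walk
begin

text \<open>The flip operation is an involution, so the forward recursion \<open>alive_Suc\<close> has the same form as the
  backward one and no conditioning on the starting point is needed.\<close>
definition alive :: "nat \<Rightarrow> bool list \<Rightarrow> real" where
  "alive t y = prob {\<omega> \<in> space M. (\<forall>s\<le>t. X s \<omega> \<in> A) \<and> X t \<omega> = y}"

declare random_variable_X [measurable]

lemma measurable_exit_time: "exit_time A X \<in> measurable M (count_space UNIV)"
proof -
  have "exit_time A X = (\<lambda>\<omega>. if \<exists>t. X t \<omega> \<notin> A then enat (LEAST t. X t \<omega> \<notin> A) else \<infinity>)"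
  proof
    fix \<omega>
    show "exit_time A X \<omega> = (if \<exists>t. X t \<omega> \<notin> A then enat (LEAST t. X t \<omega> \<notin> A) else \<infinity>)"
    proof (cases "\<exists>t. X t \<omega> \<notin> A")
      case True
      then have "X (LEAST t. X t \<omega> \<notin> A) \<omega> \<notin> A" by (rule LeastI_ex)
      then have "exit_time A X \<omega> = enat (LEAST t. X t \<omega> \<notin> A)"
        unfolding exit_time_def by (intro antisym Inf_lower Inf_greatest) (auto intro: Least_le)
      with True show ?thesis by simp
    next
      case False
      then show ?thesis by (simp add: exit_time_def top_enat_def)
    qed
  qed
  also have "\<dots> \<in> measurable M (count_space UNIV)" by measurable
  finally show ?thesis .
qed

lemma alive_nonneg: "0 \<le> alive t y"
  by (simp add: alive_def)

lemma alive_outside: "y \<notin> A \<Longrightarrow> alive t y = 0"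
proof -
  assume "y \<notin> A"
  then have "{\<omega> \<in> space M. (\<forall>s\<le>t. X s \<omega> \<in> A) \<and> X t \<omega> = y} = {}" by auto
  then show ?thesis by (simp only: alive_def measure_empty)
qed

lemma alive_0:
  assumes "finite A" "y \<in> A"
  shows "alive 0 y = 1 / real (card A)"
proof -
  have "{\<omega> \<in> space M. (\<forall>s\<le>0. X s \<omega> \<in> A) \<and> X 0 \<omega> = y} = {\<omega> \<in> space M. X 0 \<omega> = y}"
    using assms by auto
  then have "alive 0 y = pmf (pmf_of_set A) y" by (simp only: alive_def start)
  also have "\<dots> = 1 / real (card A)" using assms by (subst pmf_of_set) auto
  finally show ?thesis .
qed

text \<open>The assumption \<open>step\<close> speaks of complete histories only, so the event is
  cut into the finitely many paths inside \<open>A\<close>. The predicate \<open>Q\<close> will be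
  either the next position or \<open>True\<close>.\<close>

lemma prob_alive_paths:
  assumes "finite A" and [measurable]: "Measurable.pred M Q"
  shows "prob {\<omega> \<in> space M. ((\<forall>s\<le>t. X s \<omega> \<in> A) \<and> X t \<omega> = x) \<and> Q \<omega>} =
    (\<Sum>p\<in>{p \<in> {..t} \<rightarrow>\<^sub>E A. p t = x}. prob {\<omega> \<in> space M. (\<forall>s\<le>t. X s \<omega> = p s) \<and> Q \<omega>})"
proof -
  let ?P = "{p \<in> {..t} \<rightarrow>\<^sub>E A. p t = x}"
  let ?E = "\<lambda>p. {\<omega> \<in> space M. (\<forall>s\<le>t. X s \<omega> = p s) \<and> Q \<omega>}"
  have "{\<omega> \<in> space M. ((\<forall>s\<le>t. X s \<omega> \<in> A) \<and> X t \<omega> = x) \<and> Q \<omega>} = (\<Union>p\<in>?P. ?E p)"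
  proof (intro equalityI subsetI)
    fix \<omega> assume "\<omega> \<in> {\<omega> \<in> space M. ((\<forall>s\<le>t. X s \<omega> \<in> A) \<and> X t \<omega> = x) \<and> Q \<omega>}"
    then have "restrict (\<lambda>s. X s \<omega>) {..t} \<in> ?P" "\<omega> \<in> ?E (restrict (\<lambda>s. X s \<omega>) {..t})"
      by auto
    then show "\<omega> \<in> (\<Union>p\<in>?P. ?E p)" by blast
  qed (fastforce simp: PiE_iff)
  moreover have "disjoint_family_on ?E ?P"
    unfolding disjoint_family_on_def
  proof (intro ballI impI)
    fix p p' assume *: "p \<in> ?P" "p' \<in> ?P" "p \<noteq> p'"
    then obtain s where "s \<le> t" "p s \<noteq> p' s"
      using PiE_ext[of p "{..t}" "\<lambda>_. A" p'] by auto
    then show "?E p \<inter> ?E p' = {}" by auto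
  qed
  moreover have "finite ?P" using assms by (intro finite_subset[OF _ finite_PiE[of "{..t}" "\<lambda>_. A"]]) auto
  ultimately show ?thesis by (simp only:) (rule finite_measure_finite_Union, auto)
qed

lemma prob_alive_step:
  assumes "finite A"
  shows "prob {\<omega> \<in> space M. ((\<forall>s\<le>t. X s \<omega> \<in> A) \<and> X t \<omega> = x) \<and> X (Suc t) \<omega> = y} =
    alive t x * pmf (pmf_of_set (neighbors n x)) y"
proof -
  let ?P = "{p \<in> {..t} \<rightarrow>\<^sub>E A. p t = x}"
  have "prob {\<omega> \<in> space M. (\<forall>s\<le>t. X s \<omega> = p s) \<and> X (Suc t) \<omega> = y} =
    prob {\<omega> \<in> space M. \<forall>s\<le>t. X s \<omega> = p s} * pmf (pmf_of_set (neighbors n x)) y" if "p \<in> ?P" for p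
  proof -
    \<comment> \<open>Changing \<open>p\<close> at \<open>Suc t\<close> encodes history and next
      position in one function, as \<open>step\<close> expects.\<close>
    have "{\<omega> \<in> space M. (\<forall>s\<le>t. X s \<omega> = p s) \<and> X (Suc t) \<omega> = y} =
      {\<omega> \<in> space M. \<forall>s\<le>Suc t. X s \<omega> = (p(Suc t := y)) s}"
      by (auto simp: le_Suc_eq)
    moreover have "{\<omega> \<in> space M. \<forall>s\<le>t. X s \<omega> = p s} = {\<omega> \<in> space M. \<forall>s\<le>t. X s \<omega> = (p(Suc t := y)) s}"
      by auto
    ultimately show ?thesis using step[of t "p(Suc t := y)"] that by simp
  qed
  then have "(\<Sum>p\<in>?P. prob {\<omega> \<in> space M. (\<forall>s\<le>t. X s \<omega> = p s) \<and> X (Suc t) \<omega> = y}) =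
    (\<Sum>p\<in>?P. prob {\<omega> \<in> space M. \<forall>s\<le>t. X s \<omega> = p s}) * pmf (pmf_of_set (neighbors n x)) y"
    by (simp add: sum_distrib_right)
  then show ?thesis
    using prob_alive_paths[OF assms, of "\<lambda>\<omega>. X (Suc t) \<omega> = y" t x]
      prob_alive_paths[OF assms, of "\<lambda>_. True" t x]
    by (simp add: alive_def)
qed

text \<open>Sum over the position just before \<open>y\<close>. Adjacency is symmetric and every
  vertex has degree \<open>n\<close>, so the transition probabilities are symmetric too.\<close>

lemma alive_Suc:
  assumes n: "n \<ge> 1" and A: "A \<subseteq> cube n" and y: "y \<in> A"
  shows "alive (Suc t) y = (\<Sum>i<n. alive t (flip i y)) / real n"
proof -
  have fin: "finite A" using A finite_cube finite_subset by blast
  let ?E = "\<lambda>x. {\<omega> \<in> space M. ((\<forall>s\<le>t. X s \<omega> \<in> A) \<and> X t \<omega> = x) \<and> X (Suc t) \<omega> = y}"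
  have yc: "y \<in> cube n" using A y by auto
  have "{\<omega> \<in> space M. (\<forall>s\<le>Suc t. X s \<omega> \<in> A) \<and> X (Suc t) \<omega> = y} = (\<Union>x\<in>A. ?E x)"
    using y by (auto simp: le_Suc_eq)
  then have "alive (Suc t) y = prob (\<Union>x\<in>A. ?E x)" by (simp only: alive_def)
  also have "\<dots> = (\<Sum>x\<in>A. prob (?E x))"
    by (rule finite_measure_finite_Union) (auto simp: fin disjoint_family_on_def)
  also have "\<dots> = (\<Sum>x\<in>A. alive t x * pmf (pmf_of_set (neighbors n x)) y)"
    by (simp only: prob_alive_step[OF fin])
  also have "\<dots> = (\<Sum>x\<in>A. if x \<in> neighbors n y then alive t x / real n else 0)"
  proof (rule sum.cong)
    fix x assume "x \<in> A"
    then have x: "x \<in> cube n" using A by auto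
    have "neighbors n x \<noteq> {}" using card_neighbors[OF x] n by auto
    then show "alive t x * pmf (pmf_of_set (neighbors n x)) y =
      (if x \<in> neighbors n y then alive t x / real n else 0)"
      using neighbors_sym[OF x yc] card_neighbors[OF x]
      by (subst pmf_of_set) (auto simp: finite_neighbors indicator_def)
  qed simp
  also have "\<dots> = (\<Sum>x\<in>A \<inter> neighbors n y. alive t x / real n)"
    using fin by (simp add: sum.inter_restrict)
  \<comment> \<open>Neighbors outside \<open>A\<close> may be added because \<open>alive\<close>
    vanishes there.\<close>
  also have "\<dots> = (\<Sum>x\<in>neighbors n y. alive t x / real n)"
    by (rule sum.mono_neutral_left) (use finite_neighbors alive_outside in auto)
  also have "\<dots> = (\<Sum>i<n. alive t (flip i y) / real n)"
    unfolding neighbors_eq_flip_image[OF yc] by (simp add: sum.reindex inj_on_flip[OF yc])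
  finally show ?thesis by (simp add: sum_divide_distrib)
qed

lemma prob_alive:
  assumes "finite A"
  shows "prob {\<omega> \<in> space M. \<forall>s\<le>t. X s \<omega> \<in> A} = (\<Sum>y\<in>A. alive t y)"
proof -
  have "{\<omega> \<in> space M. \<forall>s\<le>t. X s \<omega> \<in> A} =
    (\<Union>y\<in>A. {\<omega> \<in> space M. (\<forall>s\<le>t. X s \<omega> \<in> A) \<and> X t \<omega> = y})" by auto
  then have "prob {\<omega> \<in> space M. \<forall>s\<le>t. X s \<omega> \<in> A} =
    prob (\<Union>y\<in>A. {\<omega> \<in> space M. (\<forall>s\<le>t. X s \<omega> \<in> A) \<and> X t \<omega> = y})" by (simp only:)
  also have "\<dots> = (\<Sum>y\<in>A. alive t y)" unfolding alive_def
    by (rule finite_measure_finite_Union) (auto simp: assms disjoint_family_on_def)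
  finally show ?thesis .
qed

section \<open>Mean exit times\<close>

text \<open>The tail formula: the mean of an \<open>enat\<close>-valued variable is the sum over
  \<open>t\<close> of the probability that it exceeds \<open>t\<close>.\<close>

lemma mean_exit_time_eq_suminf:
  assumes "finite A"
  shows "mean_exit_time M A X = (\<Sum>t. ennreal (\<Sum>y\<in>A. alive t y))"
proof -
  have "mean_exit_time M A X = (\<Sum>t. emeasure M {\<omega> \<in> space M. enat t < exit_time A X \<omega>})"
    unfolding mean_exit_time_def by (rule nn_integral_enat_function[OF measurable_exit_time])
  then show ?thesis
    by (simp add: enat_less_exit_time emeasure_eq_measure prob_alive[OF assms])
qed

lemma partial_sums_le:
  assumes n: "n \<ge> 1" and A: "A \<subseteq> cube n" "A \<noteq> {}"
  shows "(\<Sum>t<T. \<Sum>y\<in>A. alive t y) * log 2 (2 ^ n / real (card A)) \<le> real n"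
proof -
  have fin: "finite A" using A finite_cube finite_subset by blast
  \<comment> \<open>The Green function of the killed walk, truncated at \<open>T\<close> so that it
    is finite even when \<open>A\<close> is the whole cube.\<close>
  define U where "U y = (\<Sum>t<T. alive t y)" for y
  define S where "S = sum U A"
  have U0: "0 \<le> U y" for y by (simp add: U_def sum_nonneg alive_nonneg)
  have Uout: "U y = 0" if "y \<notin> A" for y using that by (simp add: U_def alive_outside)
  have c: "real (card A) > 0" using fin A by (simp add: card_gt_0_iff)
  have S: "sum U (cube n) = S" unfolding S_def
    using A by (intro sum.mono_neutral_right) (auto simp: finite_cube Uout)
  have bound: "(\<Sum>i<n. U y - U (flip i y)) \<le> real n / real (card A)" if y: "y \<in> A" for y
  proof -
    have "(\<Sum>i<n. U (flip i y)) = (\<Sum>t<T. \<Sum>i<n. alive t (flip i y))"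
      unfolding U_def by (rule sum.swap)
    also have "\<dots> = (\<Sum>t<T. real n * alive (Suc t) y)"
      using n by (simp add: alive_Suc[OF n A(1) y])
    finally have "(\<Sum>i<n. U y - U (flip i y)) = real n * (\<Sum>t<T. alive t y - alive (Suc t) y)"
      by (simp add: sum_subtractf sum_distrib_left U_def right_diff_distrib)
    \<comment> \<open>The recursion makes the sum telescope; only the uniform starting mass survives
      in the upper bound.\<close>
    also have "\<dots> = real n * (alive 0 y - alive T y)" 
      using sum_lessThan_telescope'[of "\<lambda>t. alive t y" T] by simp
    also have "\<dots> \<le> real n * (1 / real (card A))"
      using alive_nonneg[of T y] by (intro mult_left_mono) (simp_all add: alive_0[OF fin y])
    finally show ?thesis by simp
  qed
  have "energy n U \<le> (\<Sum>y\<in>cube n. U y * (real n / real (card A)))"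
    unfolding energy_def
  proof (rule sum_mono)
    fix y
    show "U y * (\<Sum>i<n. U y - U (flip i y)) \<le> U y * (real n / real (card A))"
    proof (cases "y \<in> A")
      case True
      then show ?thesis using bound U0 by (intro mult_left_mono) auto
    qed (simp add: Uout)
  qed
  also have "\<dots> = S * (real n / real (card A))" by (simp only: sum_distrib_right[symmetric] S)
  finally have "S\<^sup>2 / real (card A) * log 2 (2 ^ n / real (card A)) \<le> S * (real n / real (card A))"
    using energy_ge[OF A(1), of U] U0 Uout by (simp add: S)
  then have *: "S * (S * log 2 (2 ^ n / real (card A))) \<le> S * real n"
    using c by (simp add: field_simps power2_eq_square)
  have "S \<ge> 0" unfolding S_def by (simp add: sum_nonneg U0)
  then have "S * log 2 (2 ^ n / real (card A)) \<le> real n"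
    \<comment> \<open>Cancel \<open>S\<close> if it is positive; for \<open>S = 0\<close> the claim
      is \<open>0 \<le> real n\<close>.\<close>
    using * by (cases "S = 0") auto
  moreover have "S = (\<Sum>t<T. \<Sum>y\<in>A. alive t y)"
    unfolding S_def U_def by (rule sum.swap)
  ultimately show ?thesis by simp
qed

lemma mean_exit_time_le:
  assumes n: "n \<ge> 1" and A: "A \<subseteq> cube n" "A \<noteq> {}"
  shows "mean_exit_time M A X \<le> exit_bound n A"
proof -
  have fin: "finite A" using A finite_cube finite_subset by blast
  define L where "L = log 2 (2 ^ n / real (card A))"
  show ?thesis
  proof (cases "L > 0")
    case True
    have "(\<Sum>t<T. ennreal (\<Sum>y\<in>A. alive t y)) \<le> ennreal (real n / L)" for T
    proof -
      have "(\<Sum>t<T. \<Sum>y\<in>A. alive t y) \<le> real n / L"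
        using partial_sums_le[OF assms, of T] True by (simp add: L_def field_simps)
      moreover have "(\<Sum>t<T. ennreal (\<Sum>y\<in>A. alive t y)) = ennreal (\<Sum>t<T. \<Sum>y\<in>A. alive t y)"
        by (rule sum_ennreal) (simp add: sum_nonneg alive_nonneg)
      ultimately show ?thesis by (simp add: ennreal_leI)
    qed
    then have "mean_exit_time M A X \<le> ennreal (real n / L)"
      unfolding mean_exit_time_eq_suminf[OF fin] suminf_eq_SUP by (intro SUP_least)
    also have "\<dots> = exit_bound n A"
      unfolding exit_bound_def L_def[symmetric] using True by (simp add: divide_ennreal)
    finally show ?thesis .
  next
    case False
    \<comment> \<open>Here \<open>L \<le> 0\<close>, so the denominator \<open>ennreal L\<close> is
      0 while the numerator is positive.\<close>
    then have "exit_bound n A = \<top>"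
      unfolding exit_bound_def L_def[symmetric] using n by (simp add: ennreal_neg)
    then show ?thesis by simp
  qed
qed

lemma mean_exit_time_subcube:
  assumes n: "n \<ge> 1" and A: "A \<noteq> {}" and sub: "subcube n A"
  shows "mean_exit_time M A X = exit_bound n A"
proof -
  obtain S c where S: "S \<subseteq> {..<n}" and A_eq: "A = {x \<in> cube n. \<forall>i\<in>S. x ! i = c i}"
    using sub by (auto simp: subcube_def)
  have AC: "A \<subseteq> cube n" unfolding A_eq by auto
  have fin: "finite A" using AC finite_cube finite_subset by blast
  have cA: "real (card A) > 0" using fin A by (simp add: card_gt_0_iff)
  have cS: "card S \<le> n" using card_mono[OF _ S] by simp
  define r where "r = real (n - card S) / real n"
  have r: "0 \<le> r" "r \<le> 1" using n by (simp_all add: r_def divide_le_eq)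
  have flip_iff: "flip i y \<in> A \<longleftrightarrow> i \<notin> S" if "y \<in> A" "i < n" for i y
  proof -
    have nth: "flip i y ! j = (if j = i then \<not> y ! i else y ! j)" for j
      using that AC by (intro nth_flip) (auto simp: cube_def)
    show ?thesis using that by (auto simp: A_eq flip_in_cube nth)
  qed
  \<comment> \<open>The killed walk stays uniform on the subcube: from each of its points exactly
    the \<open>n - card S\<close> free flips lead back into it, so each step scales the mass by
    \<open>r\<close>.\<close>
  have al: "alive t y = r ^ t / real (card A)" if "y \<in> A" for t y
    using that
  proof (induction t arbitrary: y)
    case 0
    then show ?case by (simp add: alive_0[OF fin])
  next
    case (Suc t)
    have "(\<Sum>i<n. alive t (flip i y)) = (\<Sum>i\<in>{..<n} - S. alive t (flip i y))"
      using Suc.prems by (intro sum.mono_neutral_right) (auto simp: alive_outside flip_iff)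
    also have "\<dots> = (\<Sum>i\<in>{..<n} - S. r ^ t / real (card A))"
      using Suc.prems by (intro sum.cong refl Suc.IH) (simp add: flip_iff)
    also have "\<dots> = real (n - card S) * (r ^ t / real (card A))"
      using S by (simp add: card_Diff_subset finite_subset)
    finally show ?case
      using Suc.prems by (simp add: alive_Suc[OF n AC] r_def)
  qed
  have "(\<Sum>y\<in>A. alive t y) = r ^ t" for t using cA by (simp add: al)
  then have mean: "mean_exit_time M A X = (\<Sum>t. ennreal (r ^ t))"
    by (simp add: mean_exit_time_eq_suminf[OF fin])
  have "card A = 2 ^ (n - card S)" unfolding A_eq by (rule card_fixed_coordinates[OF S])
  then have L: "log 2 (2 ^ n / real (card A)) = real (card S)"
    using cS by (simp add: log_divide log_nat_power of_nat_diff)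
  show ?thesis
  proof (cases "card S = 0")
    \<comment> \<open>Without fixed coordinates \<open>A\<close> is the whole cube and both sides
      are infinite.\<close>
    case True
    then have "r = 1" using n by (simp add: r_def)
    then have "mean_exit_time M A X = (\<Sum>t. ennreal 1)" by (simp add: mean)
    also have "\<dots> = \<top>" using summable_iff_suminf_neq_top[of "\<lambda>_. 1"] summable_const_iff[of "1 :: real"] by simp
    also have "\<dots> = exit_bound n A"
      unfolding exit_bound_def L using n True by simp
    finally show ?thesis .
  next
    case False
    have r1: "1 - r = real (card S) / real n" using n cS by (simp add: r_def of_nat_diff field_simps)
    then have "0 < 1 - r" using False n by simp
    then have "r < 1" by simp
    then have "(\<lambda>t. r ^ t) sums (1 / (1 - r))" using r by (intro geometric_sums) simp
    then have "mean_exit_time M A X = ennreal (1 / (1 - r))"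
      unfolding mean using r by (intro suminf_ennreal_eq) auto
    also have "\<dots> = exit_bound n A"
      unfolding exit_bound_def L r1 using False by (simp add: divide_ennreal)
    finally show ?thesis .
  qed
qed

end

theorem theorem1p2:
  fixes n :: nat and A :: "bool list set"
    and M :: "'w measure" and X :: "nat \<Rightarrow> 'w \<Rightarrow> bool list"
  assumes "n \<ge> 1" and "A \<subseteq> cube n" and "A \<noteq> {}"
    and "cube_random_walk M n A X"
  shows "mean_exit_time M A X \<le> exit_bound n A \<and>
    (subcube n A \<longrightarrow> mean_exit_time M A X = exit_bound n A) \<and>
    (\<forall>B (N :: 'v measure) Z.
       subcube n B \<and> card B = card A \<and> cube_random_walk N n B Z \<longrightarrow>
       mean_exit_time M A X \<le> mean_exit_time N B Z)"
proof (intro conjI allI impI)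
  show le: "mean_exit_time M A X \<le> exit_bound n A"
    by (rule cube_random_walk.mean_exit_time_le) (use assms in auto)
  show "mean_exit_time M A X = exit_bound n A" if "subcube n A"
    by (rule cube_random_walk.mean_exit_time_subcube) (use assms that in auto)
  fix B and N :: "'v measure" and Z
  assume B: "subcube n B \<and> card B = card A \<and> cube_random_walk N n B Z"
  have "finite A" using assms(2) finite_cube finite_subset by blast
  \<comment> \<open>A finite nonempty \<open>A\<close> has positive cardinality, and
    \<open>B\<close> has the same one.\<close>
  then have "B \<noteq> {}" using B assms(3) by auto
  then have "mean_exit_time N B Z = exit_bound n B"
    by (intro cube_random_walk.mean_exit_time_subcube) (use assms(1) B in auto)
  \<comment> \<open>The bound depends on the set only through its cardinality.\<close>
  also have "\<dots> = exit_bound n A" using B by (simp add: exit_bound_def)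
  finally show "mean_exit_time M A X \<le> mean_exit_time N B Z" using le by simp
qed

end
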